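(* For every instance of the Bamboo Garden Trimming problem (every $n\ge1$ and all growth rates $h_1\ge\dots\ge h_n>0$ with $\sum_{i=1}^n h_i=1$), the makespan of Reduce-Fastest$(2)$ is at most $19/6$, and the makespan of Reduce-Fastest$\left(1+\frac{1}{\sqrt5}\right)$ is at most $1+\phi<2.62$, where $\phi=\frac{1+\sqrt5}{2}$ is the golden ratio.
   Context: Bamboo Garden Trimming (BGT) problem: a garden contains $n$ bamboos $b_1,\dots,b_n$; bamboo $b_i$ has daily growth rate $h_i>0$, with $h_1\ge\dots\ge h_n$ and $\sum_{i=1}^n h_i=1$. Initially all heights are $0$. Days are numbered $1,2,3,\dots$. At the end of each day at most one bamboo is trimmed, which instantaneously resets its height to $0$. The height of $b_i$ at the end of day $d\ge1$, before the trimming decision of that day, is $(d-d')h_i$, where $d'<d$ is the last day preceding $d$ in which $b_i$ was trimmed ($d'=0$ if $b_i$ was never trimmed before day $d$). A perpetual schedule specifies which bamboo (if any) is trimmed at the end of each day. The makespan of a schedule is the maximum height (measured at the end of a day, before trimming) ever reached by any bamboo over all days. Reduce-Fastest$(x)$: at the end of each day, trim the bamboo with the fastest daily growth rate among those whose height is at least $x$ (ties are broken in favour of the bamboo with the smallest index); if no bamboo has height at least $x$, no bamboo is trimmed that day. *)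

theory Defs
  imports Complex_Main "HOL-Library.Extended_Real"
begin

text \<open>Bamboos are indexed by \<open>{1..n}\<close>; only the values of \<open>h\<close> on \<open>{1..n}\<close> matter.\<close>

definition bgt_instance :: "nat \<Rightarrow> (nat \<Rightarrow> real) \<Rightarrow> bool" where
  "bgt_instance n h \<longleftrightarrow>
     1 \<le> n \<and> (\<forall>i\<in>{1..n}. 0 < h i) \<and>
     (\<forall>i\<in>{1..n}. \<forall>j\<in>{1..n}. i \<le> j \<longrightarrow> h j \<le> h i) \<and>
     (\<Sum>i=1..n. h i) = 1"

text \<open>\<open>S d = Some i\<close> means that bamboo \<open>i\<close> is trimmed at the end of day \<open>d\<close>, and \<open>S d = None\<close> that
  no bamboo is. Days start at \<open>1\<close>: the value \<open>S 0\<close> is never consulted.\<close>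

type_synonym schedule = "nat \<Rightarrow> nat option"

definition last_trim :: "schedule \<Rightarrow> nat \<Rightarrow> nat \<Rightarrow> nat" where
  "last_trim S i d = Max ({0} \<union> {d'. 1 \<le> d' \<and> d' < d \<and> S d' = Some i})"

text \<open>Height of bamboo \<open>i\<close> at the end of day \<open>d\<close>, before the trimming of that day.\<close>

definition height :: "(nat \<Rightarrow> real) \<Rightarrow> schedule \<Rightarrow> nat \<Rightarrow> nat \<Rightarrow> real" where
  "height h S i d = real (d - last_trim S i d) * h i"

text \<open>The supremum is taken in the extended reals, so an unbounded schedule has makespan \<open>\<infinity>\<close>.
  A finite supremum is attained, since each height is a natural multiple of one of the finitely many
  growth rates.\<close>

definition makespan :: "nat \<Rightarrow> (nat \<Rightarrow> real) \<Rightarrow> schedule \<Rightarrow> ereal" where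
  "makespan n h S = (SUP d\<in>{1..}. SUP i\<in>{1..n}. ereal (height h S i d))"

text \<open>The trimming decision of Reduce-Fastest\<open>(x)\<close> when the current heights are \<open>H\<close>. \<open>LEAST\<close>
  implements the tie-breaking rule.\<close>

definition reduce_fastest_choice ::
  "nat \<Rightarrow> (nat \<Rightarrow> real) \<Rightarrow> real \<Rightarrow> (nat \<Rightarrow> real) \<Rightarrow> nat option" where
  "reduce_fastest_choice n h x H =
     (let A = {i\<in>{1..n}. x \<le> H i}
      in if A = {} then None
         else Some (LEAST i. i \<in> A \<and> (\<forall>j\<in>A. h j \<le> h i)))"

text \<open>The decision of day \<open>d\<close> depends on the decisions of the earlier days. Cutting the schedule off
  at \<open>d\<close> only serves the termination proof; it is eliminated in \<open>reduce_fastest_eq\<close> below.\<close>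

function reduce_fastest :: "nat \<Rightarrow> (nat \<Rightarrow> real) \<Rightarrow> real \<Rightarrow> schedule" where
  "reduce_fastest n h x d =
     reduce_fastest_choice n h x
       (\<lambda>i. height h (\<lambda>e. if e < d then reduce_fastest n h x e else None) i d)"
  by pat_completeness auto
termination
  by (relation "measure (\<lambda>(n, h, x, d). d)") auto

declare reduce_fastest.simps [simp del]

lemma height_cong:
  assumes "\<And>e. e < d \<Longrightarrow> S e = T e"
  shows "height h S i d = height h T i d"
proof -
  have "{d'. 1 \<le> d' \<and> d' < d \<and> S d' = Some i} = {d'. 1 \<le> d' \<and> d' < d \<and> T d' = Some i}"
    using assms by auto
  then show ?thesis
    by (simp add: height_def last_trim_def)
qed

lemma reduce_fastest_eq:
  "reduce_fastest n h x d =
     reduce_fastest_choice n h x (\<lambda>i. height h (reduce_fastest n h x) i d)"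
proof -
  have "height h (\<lambda>e. if e < d then reduce_fastest n h x e else None) i d
      = height h (reduce_fastest n h x) i d" for i
    by (rule height_cong) simp
  then show ?thesis
    by (subst reduce_fastest.simps) simp
qed

lemma makespan_le_iff:
  "makespan n h S \<le> ereal c \<longleftrightarrow> (\<forall>d\<ge>1. \<forall>i\<in>{1..n}. height h S i d \<le> c)"
  by (auto simp: makespan_def SUP_le_iff)

definition golden_ratio :: real where
  "golden_ratio = (1 + sqrt 5) / 2"

end

(* Suppose bamboo i, of rate r, overshoots the threshold x by T. On each of the last N days,
   N + 1 > T / r, it was at least x high, so another bamboo of rate at least r was trimmed. Let k
   bamboos be trimmed in that window. Every trimming after the first of the same bamboo removes at
   least x that has grown inside the window. The first trimmings fall on k distinct days, and so do
   the last ones; hence growth of at least r k (k - 1) inside the window is not removed by these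
   trimmings, and x (N - k) <= (N - 1) (1 - r) - r k (k - 1).
   Up to lower-order terms N r (x - 1) <= k r (x - k r) <= x^2 / 4. *)
theory Submission
  imports Defs
begin

section \<open>Spaced occurrences in a finite word\<close>

text \<open>Only gaps between neighbours count: a new maximum \<open>b\<close> adds the gap after
  \<open>Max A\<close>, and the gaps telescope.\<close>

lemma spaced_set_card:
  fixes x w :: real and S :: "nat set"
  assumes "finite S" "S \<noteq> {}"
    and "\<And>s e. s \<in> S \<Longrightarrow> e \<in> S \<Longrightarrow> s < e \<Longrightarrow> x \<le> real (e - s) * w"
  shows "x * (real (card S) - 1) \<le> w * (real (Max S) - real (Min S))"
  using assms
proof (induction S rule: finite_linorder_max_induct)
  case empty
  then show ?case by simp
next
  case (insert b A)
  show ?case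
  proof (cases "A = {}")
    case True
    then show ?thesis by simp
  next
    case False
    have "Max A \<in> A" "Min A \<in> A"
      using False insert.hyps(1) by simp_all
    then have lt: "Max A < b" "Min A < b"
      using insert.hyps(2) by auto
    have IH: "x * (real (card A) - 1) \<le> w * (real (Max A) - real (Min A))"
      using insert.IH False insert.prems(2) by blast
    have "x \<le> real (b - Max A) * w"
      using insert.prems(2) \<open>Max A \<in> A\<close> lt by blast
    then have step: "x \<le> w * (real b - real (Max A))"
      using lt by (simp add: of_nat_diff mult.commute)
    have "b \<notin> A" using insert.hyps(2) by blast
    then have "real (card (insert b A)) = real (card A) + 1"
      using insert.hyps(1) by simp
    moreover have "Max (insert b A) = b" "Min (insert b A) = Min A"
      using Max_insert[OF insert.hyps(1) False, of b] Min_insert[OF insert.hyps(1) False, of b]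
      by (simp_all only: max.absorb3[OF lt(1)] min.absorb4[OF lt(2)])
    ultimately show ?thesis
      using IH step by (simp add: algebra_simps)
  qed
qed

text \<open>The new maximum \<open>b\<close> lies above all of \<open>A\<close>, hence is at least
  \<open>card A\<close>. The extremal sets are the initial segments \<open>{..<k}\<close>.\<close>

lemma sum_nat_set_ge:
  fixes S :: "nat set"
  assumes "finite S"
  shows "real (card S) * (real (card S) - 1) \<le> 2 * (\<Sum>s\<in>S. real s)"
  using assms
proof (induction S rule: finite_linorder_max_induct)
  case empty
  then show ?case by simp
next
  case (insert b A)
  have "A \<subseteq> {..<b}" using insert.hyps(2) by auto
  then have "card A \<le> b"
    using card_mono[of "{..<b}" A] by simp
  then have "real (card A) \<le> real b" by simp
  moreover have "b \<notin> A" using insert.hyps(2) by blast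
  ultimately show ?case
    using insert.IH insert.hyps(1) by (simp add: algebra_simps)
qed

lemma weighted_sum_inj_ge:
  fixes w :: "'a \<Rightarrow> real" and g :: "'a \<Rightarrow> nat"
  assumes "finite J" "inj_on g J" "0 \<le> r" "\<And>j. j \<in> J \<Longrightarrow> r \<le> w j"
  shows "r * real (card J) * (real (card J) - 1) \<le> 2 * (\<Sum>j\<in>J. w j * real (g j))"
proof -
  have "real (card J) * (real (card J) - 1) \<le> 2 * (\<Sum>j\<in>J. real (g j))"
    using sum_nat_set_ge[of "g ` J"] assms(1,2) by (simp add: card_image sum.reindex)
  then have "r * (real (card J) * (real (card J) - 1)) \<le> r * (2 * (\<Sum>j\<in>J. real (g j)))"
    using assms(3) by (rule mult_left_mono)
  also have "\<dots> = 2 * (\<Sum>j\<in>J. r * real (g j))"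
    by (simp add: sum_distrib_left algebra_simps)
  also have "\<dots> \<le> 2 * (\<Sum>j\<in>J. w j * real (g j))"
    using assms(4) by (intro mult_left_mono sum_mono mult_right_mono) auto
  finally show ?thesis by (simp add: mult.assoc)
qed

text \<open>Repetitions of \<open>j\<close> are paid for by \<open>w j * (last j - first j)\<close>.
  The two end pieces, \<open>w j * first j\<close> and \<open>w j * (N - 1 - last j)\<close>, pay
  for nothing; each kind sums over \<open>J\<close> to at least r k (k - 1) / 2, where k is
  \<open>card J\<close>.\<close>

lemma spaced_word_bound:
  fixes f :: "nat \<Rightarrow> 'a" and w :: "'a \<Rightarrow> real" and x r :: real
  assumes "0 < r" "\<And>d. d < N \<Longrightarrow> r \<le> w (f d)"
    and "\<And>s e. s < e \<Longrightarrow> e < N \<Longrightarrow> f s = f e \<Longrightarrow> x \<le> real (e - s) * w (f e)"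
  defines "J \<equiv> f ` {..<N}"
  shows "x * (real N - real (card J))
    \<le> (real N - 1) * sum w J - r * real (card J) * (real (card J) - 1)"
proof -
  define F where "F j = {d. d < N \<and> f d = j}" for j
  define first where "first j = Min (F j)" for j
  define last where "last j = Max (F j)" for j
  have fin: "finite (F j)" for j by (simp add: F_def)
  have ne: "F j \<noteq> {}" if "j \<in> J" for j using that by (auto simp: F_def J_def)
  have first: "first j < N" "f (first j) = j" if "j \<in> J" for j
    using Min_in[OF fin ne[OF that]] by (auto simp: first_def F_def)
  have last: "last j < N" "f (last j) = j" if "j \<in> J" for j
    using Max_in[OF fin ne[OF that]] by (auto simp: last_def F_def)
  have finJ: "finite J" by (simp add: J_def)
  have wr: "r \<le> w j" if "j \<in> J" for j
    using that assms(2) by (auto simp: J_def)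
  have "inj_on first J"
    using first by (metis inj_onI)
  then have sum_first: "r * real (card J) * (real (card J) - 1) \<le> 2 * (\<Sum>j\<in>J. w j * real (first j))"
    using weighted_sum_inj_ge finJ wr assms(1) by (metis less_imp_le)
  \<comment> \<open>Counted backwards from the end of the window, last occurrences are again
    distinct naturals; \<open>last j < N\<close> makes the truncated subtraction exact.\<close>
  have "inj_on (\<lambda>j. N - 1 - last j) J"
  proof (rule inj_onI)
    fix i j assume ij: "i \<in> J" "j \<in> J" "N - 1 - last i = N - 1 - last j"
    then have "last i = last j" using last(1)[of i] last(1)[of j] by linarith
    then show "i = j" using ij last(2) by metis
  qed
  then have "r * real (card J) * (real (card J) - 1)
      \<le> 2 * (\<Sum>j\<in>J. w j * real (N - 1 - last j))"
    using finJ wr assms(1) by (intro weighted_sum_inj_ge) auto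
  also have "(\<Sum>j\<in>J. w j * real (N - 1 - last j)) = (\<Sum>j\<in>J. w j * (real N - 1 - real (last j)))"
  proof (rule sum.cong)
    fix j assume "j \<in> J"
    then have "last j < N" by (rule last(1))
    then show "w j * real (N - 1 - last j) = w j * (real N - 1 - real (last j))"
      by (simp add: of_nat_diff)
  qed simp
  also have "\<dots> = (real N - 1) * sum w J - (\<Sum>j\<in>J. w j * real (last j))"
    by (simp add: sum.distrib sum_subtractf sum_distrib_left algebra_simps)
  finally have sum_last: "r * real (card J) * (real (card J) - 1)
      \<le> 2 * ((real N - 1) * sum w J - (\<Sum>j\<in>J. w j * real (last j)))" .
  \<comment> \<open>The sets \<open>F j\<close> partition the window, so N - k counts the repeated
    occurrences.\<close>
  have "card {..<N} = (\<Sum>j\<in>J. card (F j))"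
  proof -
    have "{..<N} = (\<Union>j\<in>J. F j)" by (auto simp: F_def J_def)
    also have "card \<dots> = (\<Sum>j\<in>J. card (F j))"
      using finJ fin by (intro card_UN_disjoint) (auto simp: F_def)
    finally show ?thesis .
  qed
  then have "real N = (\<Sum>j\<in>J. real (card (F j)))" by simp
  then have "x * (real N - real (card J)) = (\<Sum>j\<in>J. x * (real (card (F j)) - 1))"
    by (simp add: sum_subtractf flip: sum_distrib_left)
  also have "\<dots> \<le> (\<Sum>j\<in>J. w j * (real (last j) - real (first j)))"
  proof (rule sum_mono)
    fix j assume j: "j \<in> J"
    show "x * (real (card (F j)) - 1) \<le> w j * (real (last j) - real (first j))"
      unfolding first_def last_def
    proof (rule spaced_set_card[OF fin ne[OF j]])
      fix s e assume "s \<in> F j" "e \<in> F j" "s < e"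
      then show "x \<le> real (e - s) * w j"
        using assms(3)[of s e] by (auto simp: F_def)
    qed
  qed
  also have "\<dots> = (\<Sum>j\<in>J. w j * real (last j)) - (\<Sum>j\<in>J. w j * real (first j))"
    by (simp add: right_diff_distrib sum_subtractf)
  finally show ?thesis
    using sum_first sum_last by (simp add: algebra_simps)
qed

section \<open>Quadratic estimate of the window length\<close>

text \<open>Multiplied by r, \<open>main\<close> bounds (N + 1) r (x - 1 + r) by a concave quadratic
  in k r. The left side of \<open>small\<close> is the maximum of this quadratic over real k r,
  attained at k r = (x + r) / 2.\<close>

lemma window_length_bound:
  fixes x r T :: real and N k :: nat
  assumes "1 < x" "0 < r" "1 \<le> T" "1 \<le> k" "real (k + 1) * r \<le> 1"
    and main: "x * (real N - real k) \<le> (real N - 1) * (1 - r) - r * real k * (real k - 1)"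
    and small: "r \<le> 1/4 \<Longrightarrow> x\<^sup>2 / 4 + (3/2 * x - 2) * r + 9/4 * r\<^sup>2 \<le> T * (x - 1 + r)"
  shows "(real N + 1) * r \<le> T"
proof -
  have pos: "0 < x - 1 + r" using assms by linarith
  have N: "real N * (x - 1 + r) \<le> real k * (x + r) - r * (real k)\<^sup>2 - (1 - r)"
    using main by (simp add: algebra_simps power2_eq_square)
  have "(real N + 1) * (x - 1 + r) \<le> real k * (x + r) - r * (real k)\<^sup>2 + (x - 2 + 2 * r)"
    using N by (simp add: algebra_simps)
  then have Nr: "r * ((real N + 1) * (x - 1 + r))
      \<le> r * (real k * (x + r) - r * (real k)\<^sup>2 + (x - 2 + 2 * r))"
    using assms(2) by (intro mult_left_mono) auto
  have "r * (real k * (x + r) - r * (real k)\<^sup>2 + (x - 2 + 2 * r)) \<le> T * (x - 1 + r)"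
  proof -
    \<comment> \<open>For k <= 2 the rate r may exceed 1/4, out of reach of \<open>small\<close>;
      there the exact value of the quadratic is compared with T (x - 1 + r) through (k + 1) r <= 1
      and T >= 1.\<close>
    consider "k = 1" | "k = 2" | "3 \<le> k" using assms(4) by linarith
    then show ?thesis
    proof cases
      case 1
      then have "2 * r * (x - 1 + r) \<le> 1 * (x - 1 + r)"
        using assms(5) pos by (intro mult_right_mono) auto
      also have "\<dots> \<le> T * (x - 1 + r)"
        using assms(3) pos by (intro mult_right_mono) auto
      finally show ?thesis using 1 by (simp add: algebra_simps)
    next
      case 2
      then have "3 * r * (x - 1) \<le> 1 * (x - 1)"
        using assms(1,5) by (intro mult_right_mono) auto
      moreover have "1 * (x - 1 + r) \<le> T * (x - 1 + r)"
        using assms(3) pos by (intro mult_right_mono) auto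
      ultimately show ?thesis using 2 by (simp add: algebra_simps)
    next
      case 3
      then have "4 * r \<le> real (k + 1) * r"
        using assms(2) by (intro mult_right_mono) auto
      then have "r \<le> 1/4" using assms(5) by linarith
      note small[OF this]
      moreover have "0 \<le> (2 * (real k * r) - (x + r))\<^sup>2" by simp
      ultimately show ?thesis by (simp add: algebra_simps power2_eq_square)
    qed
  qed
  with Nr have "((real N + 1) * r) * (x - 1 + r) \<le> T * (x - 1 + r)"
    by (simp add: algebra_simps)
  then show ?thesis using pos by simp
qed

section \<open>Last trimmings and the greedy choice\<close>

lemma finite_trims:
  fixes S :: schedule
  shows "finite ({0} \<union> {d'. 1 \<le> d' \<and> d' < d \<and> S d' = Some i})"
  by simp

lemma last_trim_ge:
  assumes "1 \<le> s" "s < d" "S s = Some i"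
  shows "s \<le> last_trim S i d"
  unfolding last_trim_def using assms by (intro Max_ge[OF finite_trims]) simp

lemma last_trim_less:
  assumes "1 \<le> d"
  shows "last_trim S i d < d"
  unfolding last_trim_def using assms by (subst Max_less_iff[OF finite_trims]) auto

lemma last_trim_eq:
  assumes "last_trim S i D < d" "d \<le> D"
  shows "last_trim S i d = last_trim S i D"
proof (rule antisym)
  show "last_trim S i d \<le> last_trim S i D"
    unfolding last_trim_def using assms(2) by (intro Max_mono) auto
  have "last_trim S i D \<in> {0} \<union> {d'. 1 \<le> d' \<and> d' < D \<and> S d' = Some i}"
    unfolding last_trim_def by (rule Max_in[OF finite_trims]) simp
  then show "last_trim S i D \<le> last_trim S i d"
    using assms(1) by (auto intro: last_trim_ge)
qed

text \<open>A finite nonempty set of eligible bamboos has a fastest member, so the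
  \<open>LEAST\<close> is taken over a nonempty set and inherits eligibility and maximality.\<close>

lemma reduce_fastest_choice_SomeE:
  assumes "i \<in> {1..n}" "x \<le> H i"
  obtains j where "reduce_fastest_choice n h x H = Some j" "j \<in> {1..n}" "x \<le> H j" "h i \<le> h j"
proof -
  define A where "A = {i\<in>{1..n}. x \<le> H i}"
  let ?P = "\<lambda>i. i \<in> A \<and> (\<forall>j\<in>A. h j \<le> h i)"
  have "finite A" "i \<in> A" using assms by (auto simp: A_def)
  then have "Max (h ` A) \<in> h ` A" by (intro Max_in) auto
  then obtain m where "m \<in> A" "h m = Max (h ` A)" by auto
  then have "?P m" using \<open>finite A\<close> by simp
  then have P: "?P (LEAST i. ?P i)" by (rule LeastI)
  have "reduce_fastest_choice n h x H = Some (LEAST i. ?P i)"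
    using \<open>i \<in> A\<close> unfolding reduce_fastest_choice_def A_def[symmetric] Let_def by auto
  then show thesis
    by (rule that) (use P \<open>i \<in> A\<close> in \<open>auto simp: A_def\<close>)
qed

text \<open>After the trimming on day \<open>s\<close>, the bamboo has at most \<open>e - s\<close>
  days of growth to show on day \<open>e\<close>.\<close>

lemma reduce_fastest_gap:
  assumes "0 \<le> h j" "1 \<le> s" "s < e" "reduce_fastest n h x s = Some j"
    and "x \<le> height h (reduce_fastest n h x) j e"
  shows "x \<le> real (e - s) * h j"
proof -
  have "s \<le> last_trim (reduce_fastest n h x) j e"
    using assms by (intro last_trim_ge)
  then have "height h (reduce_fastest n h x) j e \<le> real (e - s) * h j"
    unfolding height_def using assms(1) by (intro mult_right_mono) auto
  then show ?thesis using assms(5) by linarith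
qed

section \<open>Bounding heights for a general threshold\<close>

lemma reduce_fastest_height_bound:
  fixes x T :: real
  assumes inst: "bgt_instance n h" and "1 < x" "1 \<le> T"
    and small: "\<And>r. 0 < r \<Longrightarrow> r \<le> 1/4 \<Longrightarrow>
      x\<^sup>2 / 4 + (3/2 * x - 2) * r + 9/4 * r\<^sup>2 \<le> T * (x - 1 + r)"
    and "1 \<le> D" "i \<in> {1..n}"
  shows "height h (reduce_fastest n h x) i D \<le> x + T"
proof -
  define S where "S = reduce_fastest n h x"
  define L where "L = last_trim S i D"
  \<comment> \<open>\<open>m\<close> is the number of days that \<open>i\<close> needs to reach
    \<open>x\<close>, so the window runs from \<open>a\<close> to \<open>D - 1\<close>. Truncation
    gives \<open>N = 0\<close> when \<open>D <= a\<close>.\<close>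
  define m where "m = nat \<lceil>x / h i\<rceil>"
  define a where "a = L + m"
  define N where "N = D - a"
  have h_pos: "0 < h j" if "j \<in> {1..n}" for j using inst that by (simp add: bgt_instance_def)
  have h_sum: "sum h {1..n} = 1" using inst by (simp add: bgt_instance_def)
  have hi: "0 < h i" using h_pos assms(6) .
  have hi1: "h i \<le> 1"
    using member_le_sum[of i "{1..n}" h] h_pos h_sum assms(6) by (auto simp: less_imp_le)
  have LD: "L < D" unfolding L_def using assms(5) by (rule last_trim_less)
  have xh: "0 < x / h i" using hi assms(2) by simp
  have "x / h i \<le> real m" "real m < x / h i + 1"
    using xh unfolding m_def by linarith+
  then have m: "x \<le> real m * h i" "real m * h i < x + h i"
    using hi by (simp_all add: field_simps)
  have "0 < m" using \<open>x / h i \<le> real m\<close> xh by (cases m) auto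
  have ht: "height h S i D = real (D - L) * h i"
    by (simp add: height_def L_def)
  \<comment> \<open>Rounding \<open>m\<close> up overshoots \<open>x\<close> by less than one day of
    growth: this is the \<open>+ 1\<close>.\<close>
  have ht_le: "height h S i D \<le> x + (real N + 1) * h i"
  proof -
    have "D - L \<le> N + m" by (simp add: N_def a_def)
    then have "real (D - L) * h i \<le> (real N + real m) * h i"
      using hi by (intro mult_right_mono) (auto simp flip: of_nat_add)
    then show ?thesis using m(2) ht by (simp add: algebra_simps)
  qed
  show ?thesis
  proof (cases "N = 0")
    case True
    then show ?thesis using ht_le hi1 assms(3) by (simp add: S_def)
  next
    case False
    \<comment> \<open>In the window \<open>i\<close> is eligible, but trimming it would contradict
      that \<open>L\<close> is its last trimming before \<open>D\<close>.\<close>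
    have "\<exists>j. S d = Some j \<and> j \<in> {1..n} - {i} \<and> x \<le> height h S j d \<and> h i \<le> h j"
      if "a \<le> d" "d < D" for d
    proof -
      have Ld: "L < d" using that \<open>0 < m\<close> by (simp add: a_def)
      have "last_trim S i d = L"
        using last_trim_eq[of S i D d] Ld that by (simp add: L_def)
      moreover have "real m * h i \<le> real (d - L) * h i"
        using that hi by (intro mult_right_mono) (auto simp: a_def)
      ultimately have "x \<le> height h S i d" using m(1) by (simp add: height_def)
      then obtain j where j: "reduce_fastest_choice n h x (\<lambda>i. height h S i d) = Some j"
        "j \<in> {1..n}" "x \<le> height h S j d" "h i \<le> h j"
        using reduce_fastest_choice_SomeE[of i n x "\<lambda>i. height h S i d" h] assms(6) by blast
      then have "S d = Some j"
        using reduce_fastest_eq[of n h x d] by (simp add: S_def)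
      moreover have "j \<noteq> i"
        using last_trim_ge[of d D S i] Ld that \<open>S d = Some j\<close> by (auto simp: L_def)
      ultimately show ?thesis using j by blast
    qed
    then obtain g where g: "\<And>d. a \<le> d \<Longrightarrow> d < D \<Longrightarrow>
        S d = Some (g d) \<and> g d \<in> {1..n} - {i} \<and> x \<le> height h S (g d) d \<and> h i \<le> h (g d)"
      by metis
    define f where "f t = g (a + t)" for t
    have f: "S (a + t) = Some (f t)" "f t \<in> {1..n} - {i}" "x \<le> height h S (f t) (a + t)"
      "h i \<le> h (f t)" if "t < N" for t
      using g[of "a + t"] that by (auto simp: f_def N_def)
    define J where "J = f ` {..<N}"
    have J: "J \<subseteq> {1..n} - {i}" using f(2) by (auto simp: J_def)
    have finJ: "finite J" by (simp add: J_def)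
    have "J \<noteq> {}" using False by (auto simp: J_def)
    then have card_pos: "1 \<le> card J" using finJ by (simp add: Suc_leI card_gt_0_iff)
    have "sum h J \<le> sum h ({1..n} - {i})"
      using J h_pos by (intro sum_mono2) (auto simp: less_imp_le)
    also have "\<dots> = 1 - h i"
      using h_sum assms(6) by (simp add: sum_diff1)
    finally have sumJ: "sum h J \<le> 1 - h i" .
    have "real (card J) * h i \<le> sum h J"
      using f(4) by (intro sum_bounded_below) (auto simp: J_def)
    then have card_le: "real (card J + 1) * h i \<le> 1"
      using sumJ by (simp add: algebra_simps)
    have gap: "x \<le> real (e - s) * h (f e)" if "s < e" "e < N" "f s = f e" for s e
    proof -
      have "0 \<le> h (f e)" using f(4)[of e] that hi by linarith
      \<comment> \<open>Even if \<open>L = 0\<close>, the window avoids day 0, which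
        \<open>last_trim\<close> ignores.\<close>
      moreover have "1 \<le> a + s" using \<open>0 < m\<close> by (simp add: a_def)
      ultimately show ?thesis
        using reduce_fastest_gap[of h "f e" "a + s" "a + e" n x] f[of s] f[of e] that
        by (simp add: S_def)
    qed
    have "x * (real N - real (card J))
        \<le> (real N - 1) * sum h J - h i * real (card J) * (real (card J) - 1)"
      unfolding J_def by (rule spaced_word_bound[OF hi]) (use f(4) gap in auto)
    \<comment> \<open>\<open>N\<close> is at least 1 here, so the factor is nonnegative.\<close>
    moreover have "(real N - 1) * sum h J \<le> (real N - 1) * (1 - h i)"
      using sumJ False by (intro mult_left_mono) auto
    ultimately have "x * (real N - real (card J))
        \<le> (real N - 1) * (1 - h i) - h i * real (card J) * (real (card J) - 1)"
      by linarith
    then have "(real N + 1) * h i \<le> T"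
      using window_length_bound[of x "h i" T "card J" N] assms(2,3) hi card_pos card_le small
      by blast
    then show ?thesis using ht_le by (simp add: S_def)
  qed
qed

section \<open>The two thresholds\<close>

theorem corollary3:
  fixes n :: nat and h :: "nat \<Rightarrow> real"
  assumes "bgt_instance n h"
  shows "makespan n h (reduce_fastest n h 2) \<le> ereal (19 / 6)
    \<and> makespan n h (reduce_fastest n h (1 + 1 / sqrt 5)) \<le> ereal (1 + golden_ratio)
    \<and> 1 + golden_ratio < 2.62"
proof (intro conjI)
  \<comment> \<open>The overshoot allowed is T = 19/6 - 2 = 7/6.\<close>
  have "height h (reduce_fastest n h 2) i D \<le> 2 + 7/6" if "1 \<le> D" "i \<in> {1..n}" for i D
  proof (rule reduce_fastest_height_bound[OF assms _ _ _ that])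
    fix r :: real assume "0 < r" "r \<le> 1/4"
    then have "r * r \<le> 1/4 * (1/4)" by (intro mult_mono) auto
    then show "2\<^sup>2 / 4 + (3/2 * 2 - 2) * r + 9/4 * r\<^sup>2 \<le> 7/6 * (2 - 1 + r)"
      using \<open>0 < r\<close> by (simp add: power2_eq_square)
  qed auto
  then show "makespan n h (reduce_fastest n h 2) \<le> ereal (19 / 6)"
    by (simp add: makespan_le_iff)
next
  \<comment> \<open>As r tends to 0, \<open>small\<close> asks for T >= x^2 / (4 (x - 1)). Over x >
    1, the sum x + x^2 / (4 (x - 1)) is least at x = 1 + s, with value
    \<open>1 + golden_ratio\<close>.\<close>
  define s where "s = 1 / sqrt 5"
  have s2: "s * s = 1/5" by (simp add: s_def)
  have s_pos: "0 < s" by (simp add: s_def)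
  \<comment> \<open>This is equivalent to T >= 1 for T = 1/2 + 3/2 s.\<close>
  have s_ge: "1/3 \<le> s"
    using power2_le_imp_le[of "1/3" s] s2 s_pos by (simp add: power2_eq_square)
  have sqrt5: "sqrt 5 = 5 * s" by (simp add: s_def real_div_sqrt)
  have eq: "1 + golden_ratio = (1 + s) + (1/2 + 3/2 * s)"
    by (simp add: golden_ratio_def sqrt5 field_simps)
  have "height h (reduce_fastest n h (1 + s)) i D \<le> (1 + s) + (1/2 + 3/2 * s)"
    if "1 \<le> D" "i \<in> {1..n}" for i D
  proof (rule reduce_fastest_height_bound[OF assms _ _ _ that])
    fix r :: real assume r: "0 < r" "r \<le> 1/4"
    then have "r\<^sup>2 \<le> 1/4 * r"
      unfolding power2_eq_square by (intro mult_right_mono) auto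
    \<comment> \<open>The constant term vanishes by \<open>s2\<close>; the rest is at most 9/16 r -
      r < 0.\<close>
    moreover have "(1 + s)\<^sup>2 / 4 + (3/2 * (1 + s) - 2) * r + 9/4 * r\<^sup>2
        - (1/2 + 3/2 * s) * (1 + s - 1 + r) = 9/4 * r\<^sup>2 - r + (1/4 - 5/4 * (s * s))"
      by (simp add: field_simps power2_eq_square)
    ultimately show "(1 + s)\<^sup>2 / 4 + (3/2 * (1 + s) - 2) * r + 9/4 * r\<^sup>2
        \<le> (1/2 + 3/2 * s) * (1 + s - 1 + r)"
      using s2 r(1) by linarith
  qed (use s_ge in auto)
  then show "makespan n h (reduce_fastest n h (1 + 1 / sqrt 5)) \<le> ereal (1 + golden_ratio)"
    unfolding makespan_le_iff eq by (simp add: s_def)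
next
  have "sqrt 5 < 2.24" by (rule real_less_lsqrt) (auto simp: power2_eq_square)
  then show "1 + golden_ratio < 2.62" by (simp add: golden_ratio_def)
qed

end
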